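(* For $i\in\{0,\dots,n\}$, the map $$(\pi_0,\dots,\pi_{s-1},0_{c_{b_i}})\mapsto\bigl((\eta(\pi_0),\dots,\eta(\pi_{s-1}),\eta(\omega_i)),(\zeta(\pi_0),\dots,\zeta(\pi_{s-1}),\zeta(\omega_i))\bigr)$$ is a bijection from $\mathcal P_{i,\rho}$ to $\mathcal F^{0_{c_{\overline{i+1}}},0_{c_i}}_>$ if $i\in\{1,\dots,n\}$, and to $\mathcal F^{0_{c_{\overline1}},(-1)_{c_{\overline1}}}_>$ if $i=0$; it preserves the size and the colour sequence of all parts except the last.
   Context: $\overline{[n]}=\{1<\dots<n<\overline n<\dots<\overline1\}$, $\overline{\overline k}=k$, and $\overline{n+1}:=n$. $\chi$ = truth value in $\{0,1\}$. Primary-coloured integers $k_{c_u}$ ($u\in\overline{[n]}$) with $k_{c_u}\ge l_{c_v}$ iff $k-l\ge\chi(u<v)$ and $k_{c_u}>l_{c_v}$ iff $k-l\ge\chi(u\le v)$; $k_c+1=(k+1)_c$. Secondary colours $c_{x,y}=c_xc_y$ ($x\le y$), with $\eta(2k_{c_{x,y}})=k_{c_y}$, $\zeta(2k_{c_{x,y}})=k_{c_x}$, $\eta((2k+1)_{c_{x,y}})=(k+1)_{c_x}$, $\zeta((2k+1)_{c_{x,y}})=k_{c_y}$. $\omega_0=(-1)_{c_{\overline1,\overline1}}$, $\omega_i=0_{c_{i,\overline{i+1}}}$ for $i\ge1$. Energy $H$ on $\mathcal B=\{\emptyset\}\sqcup\{(x,y):x\le y\in\overline{[n]}\}$: $H(\emptyset\otimes\emptyset)=0$,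 $H(\emptyset\otimes(x,y))=H((x,y)\otimes\emptyset)=1$, $H((x,y)\otimes(x',y'))=\chi(x\ge x')+\chi(y\ge y')-\chi(y\ge y'>x\ge x')$ if $\overline{y'}\ne x$, $=\chi(x>x')+\chi(y>y')-\chi(y>y'>x>x')$ if $\overline{y'}=x$. Colours $c_b$ ($b\in\mathcal B$), $c_{(x,y)}=c_{x,y}$; $b_0=\emptyset$, $b_k=(k,\overline k)$. $\mathcal S=\{c_{x,y}\}$, $c_\infty$ new; $\rho_i(c_{b_i},c_\infty)=1$, $\rho_i(c_b,c_\infty)=H(b_i\otimes b)$ for $c_b\in\mathcal S\setminus\{c_{b_i}\}$, $\rho_i(c_{x',y'},c_{x,y})=\chi(x\ge x')+\chi(y\ge y')-\chi(y\ge y'>x\ge x')$. $\mathcal P_{i,\rho}$ is the set of sequences $(\pi_0,\dots,\pi_{s-1},0_{c_{b_i}})$ of coloured integers with $c(\pi_j)\in\mathcal S$ ($j<s$) such that, reading the last part as $0_{c_\infty}$, $|\pi_j|-|\pi_{j+1}|\ge\rho_i(c(\pi_j),c(\pi_{j+1}))$ for $j<s$. For primary-coloured $k_c,l_d$ with $l_d\le k_c\le(l+1)_d$, $\mathcal F^{k_c,l_d}_>$ is the set of pairs $(\mu,\nu)$, $\mu=(\mu_0,\dots,\mu_{s-1},k_c)$, $\nu=(\nu_0,\dots,\nu_{s-1},l_d)$, strictly decreasing for $>$, with $\nu_j+1\ge\mu_j\ge\nu_j$ for $j<s$; size $\sum_{j<s}(|\mu_j|+|\nu_j|)$ and colour sequence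 $\prod_{j<s}c(\mu_j)c(\nu_j)$. *)

theory Defs
  imports Main
begin

text \<open>\<open>Pl k\<close> stands for the letter k, \<open>Ba k\<close> for the barred letter k. The order
  1 < 2 < ... < bar 2 < bar 1 does not depend on n; only the carrier \<open>letters n\<close> does.\<close>

datatype letter = Pl nat | Ba nat

instantiation letter :: linorder
begin

fun less_eq_letter :: "letter \<Rightarrow> letter \<Rightarrow> bool" where
  "less_eq_letter (Pl a) (Pl b) = (a \<le> b)"
| "less_eq_letter (Pl a) (Ba b) = True"
| "less_eq_letter (Ba a) (Pl b) = False"
| "less_eq_letter (Ba a) (Ba b) = (b \<le> a)"

definition less_letter :: "letter \<Rightarrow> letter \<Rightarrow> bool" where
  "less_letter x y \<longleftrightarrow> x \<le> y \<and> \<not> y \<le> x"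

instance
proof
  fix x y z :: letter
  show "x < y \<longleftrightarrow> x \<le> y \<and> \<not> y \<le> x" by (rule less_letter_def)
  show "x \<le> x" by (cases x) auto
  show "x \<le> y \<Longrightarrow> y \<le> z \<Longrightarrow> x \<le> z" by (cases x; cases y; cases z) auto
  show "x \<le> y \<Longrightarrow> y \<le> x \<Longrightarrow> x = y" by (cases x; cases y) auto
  show "x \<le> y \<or> y \<le> x" by (cases x; cases y) auto
qed

end

definition letters :: "nat \<Rightarrow> letter set" where
  "letters n = Pl ` {1..n} \<union> Ba ` {1..n}"

fun bar :: "letter \<Rightarrow> letter" where
  "bar (Pl k) = Ba k"
| "bar (Ba k) = Pl k"

text \<open>The barred index in the range 1, ..., n + 1, with the convention that the bar of n + 1 is n.\<close>

definition barred :: "nat \<Rightarrow> nat \<Rightarrow> letter" where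
  "barred n k = (if k = n + 1 then Pl n else Ba k)"

text \<open>\<open>(k, u)\<close> is the integer k with primary colour \<open>c_u\<close>. The order is not the order of the
  product type, hence the separate names.\<close>

type_synonym primary = "int \<times> letter"

fun pge :: "primary \<Rightarrow> primary \<Rightarrow> bool" where
  "pge (k, u) (l, v) \<longleftrightarrow> k - l \<ge> of_bool (u < v)"

fun pgt :: "primary \<Rightarrow> primary \<Rightarrow> bool" where
  "pgt (k, u) (l, v) \<longleftrightarrow> k - l \<ge> of_bool (u \<le> v)"

fun pincr :: "primary \<Rightarrow> primary" where
  "pincr (k, u) = (k + 1, u)"

datatype crystal = Empty | Pr letter letter

definition crystals :: "nat \<Rightarrow> crystal set" where
  "crystals n = {Empty} \<union> {Pr x y | x y. x \<in> letters n \<and> y \<in> letters n \<and> x \<le> y}"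

fun H :: "crystal \<Rightarrow> crystal \<Rightarrow> int" where
  "H Empty Empty = 0"
| "H Empty (Pr x y) = 1"
| "H (Pr x y) Empty = 1"
| "H (Pr x y) (Pr x' y') =
     (if bar y' \<noteq> x
      then of_bool (x \<ge> x') + of_bool (y \<ge> y') - of_bool (y \<ge> y' \<and> y' > x \<and> x \<ge> x')
      else of_bool (x > x') + of_bool (y > y') - of_bool (y > y' \<and> y' > x \<and> x > x'))"

datatype colour = Col crystal | Cinf

text \<open>\<open>(k, c)\<close> is the integer k with colour c.\<close>

type_synonym coloured = "int \<times> colour"

definition sec_colours :: "nat \<Rightarrow> colour set" where
  "sec_colours n = Col ` (crystals n - {Empty})"

text \<open>The product of two primary colours: \<open>c_x c_y = c_y c_x\<close> is the secondary colour
  \<open>c_{x,y}\<close> for \<open>x \<le> y\<close>.\<close>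

definition cprod :: "letter \<Rightarrow> letter \<Rightarrow> colour" where
  "cprod u v = Col (Pr (min u v) (max u v))"

definition bgr :: "nat \<Rightarrow> crystal" where
  "bgr i = (if i = 0 then Empty else Pr (Pl i) (bar (Pl i)))"

text \<open>Halving secondary-coloured integers; only meaningful on colours \<open>Col (Pr x y)\<close>.\<close>

fun eta :: "coloured \<Rightarrow> primary" where
  "eta (k, Col (Pr x y)) = (if even k then (k div 2, y) else (k div 2 + 1, x))"
| "eta (k, _) = undefined"

fun zeta :: "coloured \<Rightarrow> primary" where
  "zeta (k, Col (Pr x y)) = (if even k then (k div 2, x) else (k div 2, y))"
| "zeta (k, _) = undefined"

definition omega :: "nat \<Rightarrow> nat \<Rightarrow> coloured" where
  "omega n i = (if i = 0 then (-1, Col (Pr (Ba 1) (Ba 1)))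
                else (0, Col (Pr (Pl i) (barred n (i + 1)))))"

text \<open>The minimal difference condition; it is only used for a first argument in \<open>sec_colours n\<close>
  and a second argument in \<open>sec_colours n\<close> or equal to \<^const>\<open>Cinf\<close>.\<close>

fun rho :: "nat \<Rightarrow> colour \<Rightarrow> colour \<Rightarrow> int" where
  "rho i (Col b) Cinf = (if b = bgr i then 1 else H (bgr i) b)"
| "rho i (Col (Pr x' y')) (Col (Pr x y)) =
     of_bool (x \<ge> x') + of_bool (y \<ge> y') - of_bool (y \<ge> y' \<and> y' > x \<and> x \<ge> x')"
| "rho i _ _ = undefined"

definition Prho :: "nat \<Rightarrow> nat \<Rightarrow> coloured list set" where
  "Prho n i = {ps @ [(0, Col (bgr i))] | ps.
     (\<forall>p \<in> set ps. snd p \<in> sec_colours n) \<and>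
     (let qs = ps @ [(0, Cinf)] in
        \<forall>j < length ps. fst (qs ! j) - fst (qs ! Suc j) \<ge> rho i (snd (qs ! j)) (snd (qs ! Suc j)))}"

text \<open>\<open>Fgt n kc ld\<close> is considered only for \<open>pge kc ld\<close> and \<open>pge (pincr ld) kc\<close>.\<close>

definition Fgt :: "nat \<Rightarrow> primary \<Rightarrow> primary \<Rightarrow> (primary list \<times> primary list) set" where
  "Fgt n kc ld = {(ms @ [kc], ns @ [ld]) | ms ns.
     length ms = length ns \<and>
     snd ` set ms \<subseteq> letters n \<and> snd ` set ns \<subseteq> letters n \<and>
     sorted_wrt pgt (ms @ [kc]) \<and> sorted_wrt pgt (ns @ [ld]) \<and>
     (\<forall>j < length ms. pge (pincr (ns ! j)) (ms ! j) \<and> pge (ms ! j) (ns ! j))}"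

lemma Fgt_boundary_admissible:
  assumes "1 \<le> i" "i \<le> n"
  shows "pge (0, barred n (i + 1)) (0, Pl i)"
    and "pge (pincr (0, Pl i)) (0, barred n (i + 1))"
    and "pge (0, Ba 1) (-1, Ba 1)"
    and "pge (pincr (-1, Ba 1)) (0, Ba 1)"
  using assms by (auto simp: barred_def less_letter_def)

definition size_P :: "coloured list \<Rightarrow> int" where
  "size_P ps = sum_list (map fst (butlast ps))"

definition colours_P :: "coloured list \<Rightarrow> colour list" where
  "colours_P ps = map snd (butlast ps)"

definition size_F :: "primary list \<times> primary list \<Rightarrow> int" where
  "size_F = (\<lambda>(ms, ns). \<Sum>(m, n) \<leftarrow> zip (butlast ms) (butlast ns). fst m + fst n)"

definition colours_F :: "primary list \<times> primary list \<Rightarrow> colour list" where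
  "colours_F = (\<lambda>(ms, ns). map (\<lambda>(m, n). cprod (snd m) (snd n)) (zip (butlast ms) (butlast ns)))"

definition Phi :: "nat \<Rightarrow> nat \<Rightarrow> coloured list \<Rightarrow> primary list \<times> primary list" where
  "Phi n i ps = (map eta (butlast ps) @ [eta (omega n i)], map zeta (butlast ps) @ [zeta (omega n i)])"

end

theory Submission
  imports Defs
begin

text \<open>A secondary-coloured integer is the sum of its two halves, and the pair of halves ranges over
  all interlaced pairs, so \<open>p \<mapsto> (eta p, zeta p)\<close> is a bijection on single parts. Comparing
  parities shows that the minimal difference condition between two parts says exactly that both
  halves strictly decrease. The condition against the final part \<open>0\<close> of colour \<open>Cinf\<close> is an instance
  of this one, with the final part replaced by \<open>omega n i\<close>. As the strict order on
  primary-coloured integers is transitive, conditions on consecutive parts suffice.\<close>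

text \<open>Inverse of halving on interlaced pairs: \<open>cprod\<close> forgets which letter
  belongs to which half, and the parity of the sum recovers it.\<close>

definition join :: "primary \<Rightarrow> primary \<Rightarrow> coloured" where
  "join m m' = (fst m + fst m', cprod (snd m) (snd m'))"

definition interlaced :: "primary \<Rightarrow> primary \<Rightarrow> bool" where
  "interlaced m m' \<longleftrightarrow> pge (pincr m') m \<and> pge m m'"

lemma sec_colours_iff:
  "c \<in> sec_colours n \<longleftrightarrow> (\<exists>x y. c = Col (Pr x y) \<and> x \<in> letters n \<and> y \<in> letters n \<and> x \<le> y)"
  by (auto simp: sec_colours_def crystals_def)

lemma letters_iff:
  "Pl k \<in> letters n \<longleftrightarrow> 1 \<le> k \<and> k \<le> n"
  "Ba k \<in> letters n \<longleftrightarrow> 1 \<le> k \<and> k \<le> n"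
  by (auto simp: letters_def)

lemma sec_coloured_cases:
  fixes p :: coloured
  assumes "snd p \<in> sec_colours n"
  obtains (even) a x y where "p = (2 * a, Col (Pr x y))" "x \<in> letters n" "y \<in> letters n" "x \<le> y"
    | (odd) a x y where "p = (2 * a + 1, Col (Pr x y))" "x \<in> letters n" "y \<in> letters n" "x \<le> y"
proof -
  obtain k x y where p: "p = (k, Col (Pr x y))" and xy: "x \<in> letters n" "y \<in> letters n" "x \<le> y"
    using assms by (cases p) (auto simp: sec_colours_iff)
  show thesis
  proof (cases "even k")
    case True
    then show thesis using p xy even by (auto elim!: evenE)
  next
    case False
    then show thesis using p xy odd by (auto elim!: oddE)
  qed
qed

lemma halves_simps:
  "eta (2 * a, Col (Pr x y)) = (a, y)" "eta (2 * a + 1, Col (Pr x y)) = (a + 1, x)"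
  "zeta (2 * a, Col (Pr x y)) = (a, x)" "zeta (2 * a + 1, Col (Pr x y)) = (a, y)"
  by simp_all

lemma letter_of_halves:
  assumes "snd p \<in> sec_colours n"
  shows "snd (eta p) \<in> letters n" "snd (zeta p) \<in> letters n"
  using assms by (cases p rule: sec_coloured_cases; simp)+

lemma interlaced_halves:
  assumes "snd p \<in> sec_colours n"
  shows "interlaced (eta p) (zeta p)"
  using assms by (cases p rule: sec_coloured_cases) (auto simp: interlaced_def)

lemma join_halves:
  assumes "snd p \<in> sec_colours n"
  shows "join (eta p) (zeta p) = p"
  using assms by (cases p rule: sec_coloured_cases) (auto simp: join_def cprod_def)

lemma halves_join:
  assumes "interlaced m m'"
  shows "eta (join m m') = m" "zeta (join m m') = m'"
proof -
  obtain a u b v where m: "m = (a, u)" "m' = (b, v)"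
    by (cases m; cases m')
  \<comment> \<open>Interlacing forces a - b to be 0 or 1, so the sum is even or odd accordingly;
    the letter inequality then identifies the minimum and the maximum in
    \<open>cprod\<close>.\<close>
  consider "a = b" "v \<le> u" | "a = b + 1" "u \<le> v"
    using assms by (fastforce simp: m interlaced_def not_le of_bool_def split: if_splits)
  then have "eta (join m m') = m \<and> zeta (join m m') = m'"
    by cases (auto simp: m join_def cprod_def min_def max_def)
  then show "eta (join m m') = m" "zeta (join m m') = m'" by simp_all
qed

lemma join_sec_coloured:
  assumes "snd m \<in> letters n" "snd m' \<in> letters n"
  shows "snd (join m m') \<in> sec_colours n"
  using assms by (auto simp: join_def cprod_def sec_colours_iff min_def max_def)

text \<open>\<open>pgt\<close> is a lexicographic strict order: integers first, then letters when
  the integers are equal.\<close>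

lemma transp_pgt: "transp pgt"
proof (rule transpI)
  fix p q r
  assume "pgt p q" "pgt q r"
  then show "pgt p r"
    by (cases p; cases q; cases r) (auto simp: of_bool_def split: if_splits)
qed

text \<open>If y' \<le> x, both positive indicators are 1 and the correction vanishes. Otherwise the
  correction cancels exactly the overlap of the two indicators and turns their sum into a
  disjunction.\<close>

lemma rho_eq:
  assumes "x' \<le> y'" "x \<le> y"
  shows "rho i (Col (Pr x' y')) (Col (Pr x y)) =
    (if y' \<le> x then 2 else if x' \<le> x \<or> y' \<le> y then 1 else 0)"
  using assms by auto

text \<open>For equal parities the difference is even, so the bounds 1 and 2 agree, and the halves
  compare x' with x and y' with y. For opposite parities it is odd, so the bounds 0 and 1 agree and
  only y' \<le> x matters; the condition on the halves that compares x' with y follows from the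
  other one.\<close>

lemma rho_iff_halves_pgt:
  assumes "snd p \<in> sec_colours n" "snd q \<in> sec_colours n"
  shows "fst p - fst q \<ge> rho i (snd p) (snd q) \<longleftrightarrow> pgt (eta p) (eta q) \<and> pgt (zeta p) (zeta q)"
proof -
  obtain k x' y' where p: "p = (k, Col (Pr x' y'))" "x' \<le> y'"
    using assms(1) by (cases p) (auto simp: sec_colours_iff)
  obtain l x y where q: "q = (l, Col (Pr x y))" "x \<le> y"
    using assms(2) by (cases q) (auto simp: sec_colours_iff)
  obtain a where k: "k = 2 * a \<or> k = 2 * a + 1" by (metis evenE oddE)
  obtain b where l: "l = 2 * b \<or> l = 2 * b + 1" by (metis evenE oddE)
  \<comment> \<open>These are all patterns of the four comparisons compatible with x' \<le> y' and x
    \<le> y. In each, fixing the parities leaves linear arithmetic.\<close>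
  consider "y' \<le> x" "x' \<le> x" "y' \<le> y" "x' \<le> y"
    | "\<not> y' \<le> x" "x' \<le> x" "y' \<le> y" "x' \<le> y"
    | "\<not> y' \<le> x" "x' \<le> x" "\<not> y' \<le> y" "x' \<le> y"
    | "\<not> y' \<le> x" "\<not> x' \<le> x" "y' \<le> y" "x' \<le> y"
    | "\<not> y' \<le> x" "\<not> x' \<le> x" "\<not> y' \<le> y" "x' \<le> y"
    | "\<not> y' \<le> x" "\<not> x' \<le> x" "\<not> y' \<le> y" "\<not> x' \<le> y"
    using p(2) q(2) by (meson order.trans)
  then show ?thesis
    unfolding p(1) q(1) fst_conv snd_conv rho_eq[OF p(2) q(2)]
    using k l
    by cases (elim disjE; simp only: halves_simps pgt.simps if_True if_False of_bool_eq simp_thms;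
      rule iffI; linarith)+
qed

text \<open>\<open>barred n (i + 1)\<close> is the immediate predecessor of \<open>Ba i\<close> in
  \<open>letters n\<close>; the convention that the bar of n + 1 is n makes this hold for i = n
  too.\<close>

lemma le_barred_iff:
  assumes "y \<in> letters n" "1 \<le> i" "i \<le> n"
  shows "y \<le> barred n (i + 1) \<longleftrightarrow> y < Ba i"
  using assms by (cases y; cases "i = n"; simp add: barred_def less_letter_def letters_iff; linarith)

lemma omega_sec_coloured:
  assumes "1 \<le> n" "i \<le> n"
  shows "snd (omega n i) \<in> sec_colours n"
  using assms
  by (cases "i = 0"; cases "i = n") (simp_all add: omega_def sec_colours_iff letters_iff barred_def)

lemma rho_Cinf_eq:
  assumes "c \<in> sec_colours n" "i \<le> n"
  shows "rho i c Cinf = rho i c (snd (omega n i)) + fst (omega n i)"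
proof -
  obtain x y where c: "c = Col (Pr x y)" and xy: "x \<in> letters n" "y \<in> letters n" "x \<le> y"
    using assms(1) by (auto simp: sec_colours_iff)
  show ?thesis
  proof (cases "i = 0")
    case True
    \<comment> \<open>\<open>Ba 1\<close> is the largest letter, so the bound against
      \<open>omega n 0\<close> is always 2; its integer -1 lowers this to the 1 given by
      \<open>H Empty\<close>.\<close>
    have "y \<le> Ba 1" using xy(2) by (cases y) (simp_all add: letters_iff)
    then show ?thesis
      using rho_eq[OF xy(3) order_refl, of i "Ba 1"] by (simp add: True c omega_def bgr_def)
  next
    case False
    then have i: "1 \<le> i" by simp
    have lt: "Pl i < Ba i" by (simp add: less_letter_def)
    have bar_eq: "bar y = Pl i \<longleftrightarrow> y = Ba i" by (cases y) auto
    have "Pl i \<le> barred n (i + 1)" using assms(2) by (simp add: barred_def)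
    then have "rho i c (snd (omega n i)) + fst (omega n i) =
        (if y \<le> Pl i then 2 else if x \<le> Pl i \<or> y < Ba i then 1 else 0)"
      using rho_eq[OF xy(3), of "Pl i" "barred n (i + 1)" i] False
      unfolding le_barred_iff[OF xy(2) i assms(2)] by (simp add: c omega_def)
    moreover have "rho i c Cinf = (if y \<le> Pl i then 2 else if x \<le> Pl i \<or> y < Ba i then 1 else 0)"
    proof (cases y "Ba i" rule: linorder_cases)
      case less
      then show ?thesis using False xy(3) by (auto simp: c bgr_def bar_eq)
    next
      case equal
      \<comment> \<open>Here \<open>H\<close> takes its strict branch, which misses x =
        \<open>Pl i\<close>; that colour is \<open>bgr i\<close>, for which \<open>rho\<close> is
        set to 1 separately.\<close>
      then show ?thesis using False lt by (auto simp: c bgr_def)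
    next
      case greater
      then show ?thesis using False lt by (auto simp: c bgr_def bar_eq)
    qed
    ultimately show ?thesis by simp
  qed
qed

lemma rho_Cinf_iff_halves_pgt:
  assumes "snd p \<in> sec_colours n" "1 \<le> n" "i \<le> n"
  shows "fst p \<ge> rho i (snd p) Cinf \<longleftrightarrow>
    pgt (eta p) (eta (omega n i)) \<and> pgt (zeta p) (zeta (omega n i))"
  using rho_iff_halves_pgt[OF assms(1) omega_sec_coloured[OF assms(2,3)], of i]
    rho_Cinf_eq[OF assms(1,3)] by (simp add: algebra_simps)

lemma sorted_wrt_pgt_iff_successive:
  "sorted_wrt pgt (map f ps @ [f q]) \<longleftrightarrow>
    (\<forall>j < length ps. pgt (f ((ps @ [q]) ! j)) (f ((ps @ [q]) ! Suc j)))"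
  using sorted_wrt_iff_nth_Suc_transp[OF transp_pgt, of "map f (ps @ [q])"]
  by (simp del: map_append) simp

lemma Prho_iff:
  assumes "1 \<le> n" "i \<le> n"
  shows "xs \<in> Prho n i \<longleftrightarrow> (\<exists>ps. xs = ps @ [(0, Col (bgr i))] \<and> (\<forall>p \<in> set ps. snd p \<in> sec_colours n) \<and>
    sorted_wrt pgt (map eta ps @ [eta (omega n i)]) \<and>
    sorted_wrt pgt (map zeta ps @ [zeta (omega n i)]))"
proof -
  have "fst (qs ! j) - fst (qs ! Suc j) \<ge> rho i (snd (qs ! j)) (snd (qs ! Suc j)) \<longleftrightarrow>
      pgt (eta (rs ! j)) (eta (rs ! Suc j)) \<and> pgt (zeta (rs ! j)) (zeta (rs ! Suc j))"
    if sec: "\<forall>p \<in> set ps. snd p \<in> sec_colours n" and j: "j < length ps"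
      and qs: "qs = ps @ [(0, Cinf)]" and rs: "rs = ps @ [omega n i]" for ps qs rs j
  proof (cases "Suc j < length ps")
    case True
    then show ?thesis
      using sec j rho_iff_halves_pgt[of "ps ! j" n "ps ! Suc j" i] by (simp add: qs rs nth_append)
  next
    case False
    \<comment> \<open>\<open>qs\<close> and \<open>rs\<close> differ only in their final entry,
      which is met just here; its integer in \<open>qs\<close> is 0.\<close>
    then have "Suc j = length ps" using j by simp
    then show ?thesis
      using sec j rho_Cinf_iff_halves_pgt[of "ps ! j" n i] assms by (simp add: qs rs nth_append)
  qed
  then show ?thesis
    unfolding Prho_def Let_def sorted_wrt_pgt_iff_successive by auto
qed

lemma Fgt_iff:
  "X \<in> Fgt n kc ld \<longleftrightarrow> (\<exists>ms ns. X = (ms @ [kc], ns @ [ld]) \<and> list_all2 interlaced ms ns \<and>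
     snd ` set ms \<subseteq> letters n \<and> snd ` set ns \<subseteq> letters n \<and>
     sorted_wrt pgt (ms @ [kc]) \<and> sorted_wrt pgt (ns @ [ld]))"
  unfolding Fgt_def list_all2_conv_all_nth interlaced_def by blast

lemma map_halves_map2_join:
  assumes "list_all2 interlaced ms ns"
  shows "map eta (map2 join ms ns) = ms" "map zeta (map2 join ms ns) = ns"
  using assms by (induction rule: list_all2_induct) (auto simp: halves_join)

lemma map2_join_map_halves:
  assumes "\<forall>p \<in> set ps. snd p \<in> sec_colours n"
  shows "map2 join (map eta ps) (map zeta ps) = ps"
  using assms by (induction ps) (auto simp: join_halves)

lemma bij_betw_Phi:
  assumes "1 \<le> n" "i \<le> n"
  shows "bij_betw (Phi n i) (Prho n i) (Fgt n (eta (omega n i)) (zeta (omega n i)))"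
\<comment> \<open>The final pair would join to \<open>omega n i\<close> and not to the final part,
  so it is dropped and that fixed part is appended instead.\<close>
proof (rule bij_betw_byWitness[where f' =
    "\<lambda>(ms, ns). map2 join (butlast ms) (butlast ns) @ [(0, Col (bgr i))]"])
  show "Phi n i ` Prho n i \<subseteq> Fgt n (eta (omega n i)) (zeta (omega n i))"
  proof (rule image_subsetI)
    fix xs
    assume "xs \<in> Prho n i"
    then obtain ps where "xs = ps @ [(0, Col (bgr i))]" "\<forall>p \<in> set ps. snd p \<in> sec_colours n"
      "sorted_wrt pgt (map eta ps @ [eta (omega n i)])"
      "sorted_wrt pgt (map zeta ps @ [zeta (omega n i)])"
      unfolding Prho_iff[OF assms] by blast
    then show "Phi n i xs \<in> Fgt n (eta (omega n i)) (zeta (omega n i))"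
      using letter_of_halves[of _ n] interlaced_halves[of _ n]
      by (simp add: Fgt_iff Phi_def list_all2_map1 list_all2_map2 list_all2_same image_subset_iff)
  qed
  show "(\<lambda>(ms, ns). map2 join (butlast ms) (butlast ns) @ [(0, Col (bgr i))]) `
      Fgt n (eta (omega n i)) (zeta (omega n i)) \<subseteq> Prho n i"
  proof (rule image_subsetI)
    fix X
    assume "X \<in> Fgt n (eta (omega n i)) (zeta (omega n i))"
    then obtain ms ns where X: "X = (ms @ [eta (omega n i)], ns @ [zeta (omega n i)])"
      and il: "list_all2 interlaced ms ns"
      and letters: "snd ` set ms \<subseteq> letters n" "snd ` set ns \<subseteq> letters n"
      and sorted: "sorted_wrt pgt (ms @ [eta (omega n i)])" "sorted_wrt pgt (ns @ [zeta (omega n i)])"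
      unfolding Fgt_iff by blast
    have "\<forall>p \<in> set (map2 join ms ns). snd p \<in> sec_colours n"
      using letters by (auto simp: image_subset_iff intro!: join_sec_coloured elim!: in_set_zipE)
    then show "(\<lambda>(ms, ns). map2 join (butlast ms) (butlast ns) @ [(0, Col (bgr i))]) X \<in> Prho n i"
      unfolding X Prho_iff[OF assms] using sorted map_halves_map2_join[OF il]
      \<comment> \<open>\<open>map2\<close> is a \<open>map\<close> over \<open>zip\<close>;
        \<open>map_map\<close> would fuse it with the halving maps and hide the pattern that
        \<open>map_halves_map2_join\<close> cancels.\<close>
      by (simp del: map_map set_map)
  qed
qed (auto simp: Prho_iff[OF assms] Fgt_iff Phi_def map2_join_map_halves map_halves_map2_join
    simp del: map_map)

lemma size_colours_Phi:
  assumes "ps \<in> Prho n i"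
  shows "size_F (Phi n i ps) = size_P ps" "colours_F (Phi n i ps) = colours_P ps"
proof -
  obtain qs where ps: "ps = qs @ [(0, Col (bgr i))]" and sec: "\<forall>p \<in> set qs. snd p \<in> sec_colours n"
    using assms by (auto simp: Prho_def)
  have "fst (eta p) + fst (zeta p) = fst p" "cprod (snd (eta p)) (snd (zeta p)) = snd p"
    if "p \<in> set qs" for p
    using join_halves[of p n] that sec by (auto simp: join_def prod_eq_iff)
  then show "size_F (Phi n i ps) = size_P ps" "colours_F (Phi n i ps) = colours_P ps"
    by (auto simp: ps size_F_def size_P_def colours_F_def colours_P_def Phi_def zip_map_map
        zip_same_conv_map intro!: arg_cong[where f = sum_list])
qed

theorem theorem4p3:
  fixes n i :: nat
  assumes "1 \<le> n" and "i \<le> n"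
  shows "bij_betw (Phi n i) (Prho n i)
           (if i = 0 then Fgt n (0, Ba 1) (-1, Ba 1)
            else Fgt n (0, barred n (i + 1)) (0, Pl i))
       \<and> (\<forall>ps \<in> Prho n i. size_F (Phi n i ps) = size_P ps
            \<and> colours_F (Phi n i ps) = colours_P ps)"
  \<comment> \<open>The halves of \<open>omega n i\<close> are evaluated: for i = 0 the integer -1
    is odd and \<open>-1 div 2 = -1\<close>, which gives the integers 0 and -1.\<close>
  using bij_betw_Phi[OF assms] by (auto simp: size_colours_Phi omega_def)

end
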